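(* Let $C$ be a nonempty, closed, bounded, convex, weakly compact subset of a real Banach space $X$ with $\delta=\mathrm{diam}(C)$, and let $f:X\to\mathbb{R}$ be a convex, continuously Fréchet differentiable function whose Fréchet derivative $f'$ is uniformly continuous on $C$. Assume $f$ attains its minimum over $C$ and put $f^*=\min_{x\in C}f(x)$. Assume there exists $\sigma\in(1,2]$ such that the curvature constant of order $\sigma$ of $f$ over $C$, $C_f^{(\sigma)}$, is finite. Let $\{x_k\}_{k\ge0}$ be a sequence generated by the Frank-Wolfe algorithm from an arbitrary $x_0\in C$, with each stepsize selected by line minimization search, i.e. $\gamma_k\in[0,1]$ is a minimizer of $\gamma\mapsto f(x_k+\gamma(\bar x_k-x_k))$ over $[0,1]$. Then, with $\theta=f(x_0)-f^*$, $$f(x_k)-f^*\le\frac{\theta}{\left(1+\frac1\sigma\,\theta^{\frac1{\sigma-1}}\,(C_f^{(\sigma)})^{\frac1{1-\sigma}}\,k\right)^{\sigma-1}}=O\left(\frac1{k^{\sigma-1}}\right).$$ In particular: - If $f'$ is $\nu$-Hölder continuous ($\nu\in(0,1]$) with constant $L_\nu$, then $$f(x_k)-f^*\le\frac{\theta}{\left(1+\frac1{1+\nu}\,\theta^{\frac1\nu}\,(L_\nu\delta^{1+\nu})^{-\frac1\nu}\,k\right)^{\nu}}=O\left(\frac1{k^\nu}\right).$$ - If $f'$ is Lipschitz continuous with constant $L$, then $$f(x_k)-f^*\le\frac{\theta}{1+\frac{\theta}{2L\delta^2}\,k}=O\left(\frac1k\right).$$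
   Context: $X^*$ is the dual of $X$ and $\langle\cdot,\cdot\rangle$ the duality pairing. Frank-Wolfe algorithm for $\min_{x\in C}f(x)$: given $x_0\in C$, for each $k\ge 0$ choose $\bar x_k\in C$ to be a minimizer of $x\mapsto\langle f'(x_k),x\rangle$ over $C$, and set $x_{k+1}=x_k+\gamma_k(\bar x_k-x_k)$. For $\sigma\in(1,2]$, the curvature constant of order $\sigma$ of $f$ over $C$ is $$C_f^{(\sigma)}=\sup\Big\{\frac{\sigma}{\gamma^\sigma}\big(f(y)-f(x)-\langle f'(x),y-x\rangle\big): x,s\in C,\ \gamma\in(0,1],\ y=x+\gamma(s-x)\Big\}\in[0,\infty].$$ $f'$ is $\nu$-Hölder continuous with constant $L_\nu>0$ if $\|f'(x)-f'(y)\|\le L_\nu\|x-y\|^\nu$ for all $x,y$; Lipschitz with constant $L>0$ is the case $\nu=1$. $\mathrm{diam}(C)=\sup\{\|u-v\|:u,v\in C\}$. *)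

theory Defs
  imports "HOL-Analysis.Analysis" "HOL-Library.Landau_Symbols"
begin

text \<open>The coarsest topology on the space making every element of the dual continuous.\<close>

definition weak_topology :: "'a::real_normed_vector topology" where
  "weak_topology =
     topology_generated_by {blinfun_apply \<phi> -` U | (\<phi> :: 'a \<Rightarrow>\<^sub>L real) U. open U}"

definition curvature_constant ::
    "('a::real_normed_vector \<Rightarrow> real) \<Rightarrow> ('a \<Rightarrow> 'a \<Rightarrow>\<^sub>L real) \<Rightarrow> 'a set \<Rightarrow> real \<Rightarrow> ereal" where
  "curvature_constant f f' C \<sigma> =
     Sup {ereal (\<sigma> / \<gamma> powr \<sigma> * (f y - f x - blinfun_apply (f' x) (y - x))) | x s \<gamma> y.
            x \<in> C \<and> s \<in> C \<and> 0 < \<gamma> \<and> \<gamma> \<le> 1 \<and> y = x + \<gamma> *\<^sub>R (s - x)}"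

definition frank_wolfe_sequence ::
    "('a::real_normed_vector \<Rightarrow> 'a \<Rightarrow>\<^sub>L real) \<Rightarrow> 'a set \<Rightarrow>
     (nat \<Rightarrow> 'a) \<Rightarrow> (nat \<Rightarrow> 'a) \<Rightarrow> (nat \<Rightarrow> real) \<Rightarrow> bool" where
  "frank_wolfe_sequence f' C x xbar \<gamma> \<longleftrightarrow>
     x 0 \<in> C \<and>
     (\<forall>k. is_arg_min (blinfun_apply (f' (x k))) (\<lambda>z. z \<in> C) (xbar k) \<and>
          x (Suc k) = x k + \<gamma> k *\<^sub>R (xbar k - x k))"

definition line_minimization ::
    "('a::real_normed_vector \<Rightarrow> real) \<Rightarrow>
     (nat \<Rightarrow> 'a) \<Rightarrow> (nat \<Rightarrow> 'a) \<Rightarrow> (nat \<Rightarrow> real) \<Rightarrow> bool" where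
  "line_minimization f x xbar \<gamma> \<longleftrightarrow>
     (\<forall>k. is_arg_min (\<lambda>t. f (x k + t *\<^sub>R (xbar k - x k))) (\<lambda>t. t \<in> {0..1}) (\<gamma> k))"

text \<open>
  Real powers of an element of \<open>[0, \<infinity>]\<close>, with \<open>0\<close> to a negative power being \<open>\<infinity>\<close>
  (\<^const>\<open>powr\<close> would give \<open>0\<close>).
\<close>

definition epowr :: "ereal \<Rightarrow> real \<Rightarrow> ereal" where
  "epowr c a =
     (if a = 0 then 1
      else if c = 0 then (if a < 0 then \<infinity> else 0)
      else if c = \<infinity> then (if a < 0 then 0 else \<infinity>)
      else ereal (real_of_ereal c powr a))"

text \<open>
  The curvature constant \<open>c\<close> vanishes when \<open>f\<close> is affine on the feasible set, so the bound is
  evaluated in the extended reals, where \<open>0 * \<infinity> = 0\<close> and \<open>\<theta> / \<infinity> = 0\<close>.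
\<close>

definition curvature_rate :: "real \<Rightarrow> real \<Rightarrow> ereal \<Rightarrow> nat \<Rightarrow> ereal" where
  "curvature_rate \<sigma> \<theta> c k =
     ereal \<theta> /
     epowr (1 + ereal (1 / \<sigma>) * ereal (\<theta> powr (1 / (\<sigma> - 1))) *
              epowr c (1 / (1 - \<sigma>)) * ereal (real k)) (\<sigma> - 1)"

end

theory Submission
  imports Defs
begin

text \<open>
  Write \<open>h\<^sub>k = f (x\<^sub>k) - f\<^sup>*\<close>. Convexity bounds the Frank-Wolfe gap from below by \<open>h\<^sub>k\<close>, so the
  curvature bound and line minimization give
  \<open>h\<^sub>k\<^sub>+\<^sub>1 \<le> (1 - t) h\<^sub>k + c t\<^sup>\<sigma> / \<sigma>\<close> for all \<open>t \<in> (0, 1]\<close>.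
  With \<open>p = 1 / (\<sigma> - 1)\<close>, the choice \<open>t = min 1 ((h\<^sub>k / c) powr p)\<close> shows that \<open>h\<^sub>k powr (- p)\<close>
  grows by at least \<open>c powr (- p) / \<sigma>\<close> in each step. If \<open>f'\<close> is \<open>\<nu>\<close>-Hoelder with constant \<open>L\<close>, then
  \<open>c = L * \<delta> powr (1 + \<nu>)\<close> is admissible for \<open>\<sigma> = 1 + \<nu>\<close>.
\<close>

section \<open>Scalar inequalities and the decay rate of the recurrence\<close>

text \<open>A Bernoulli inequality for negative exponents, from \<open>ln (1 - q) \<le> - q\<close>
  and \<open>1 + y \<le> exp y\<close>. It turns contraction by the factor \<open>1 - q\<close> into
  additive growth of the power \<open>- p\<close>.\<close>

lemma one_minus_powr_ge:
  fixes p q :: real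
  assumes "0 \<le> p" "q < 1"
  shows "1 + p * q \<le> (1 - q) powr (- p)"
proof -
  have "ln (1 - q) \<le> - q" using ln_le_minus_one[of "1 - q"] assms by simp
  then have "p * q \<le> - p * ln (1 - q)" using assms(1)
    using mult_left_mono[of "ln (1-q)" "-q" p] by simp
  also have "1 + \<dots> \<le> exp (- p * ln (1 - q))" by (rule exp_ge_add_one_self)
  finally show ?thesis using assms by (simp add: powr_def)
qed

text \<open>By convexity \<open>2 powr s\<close> lies below its chord \<open>1 + s\<close> on
  [0, 1]; take \<open>s = \<sigma> - 1\<close>. The factor 2 later absorbs two terms when the full
  step \<open>t = 1\<close> is taken.\<close>

lemma powr_inverse_pred_ge_2:
  fixes \<sigma> :: real
  assumes "1 < \<sigma>" "\<sigma> \<le> 2"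
  shows "2 \<le> \<sigma> powr (1 / (\<sigma> - 1))"
proof -
  have "convex_on UNIV (\<lambda>t::real. exp (t * ln 2))"
    by (rule f''_ge0_imp_convex[where f'="\<lambda>t. ln 2 * exp (t * ln 2)"
          and f''="\<lambda>t. ln 2 * (ln 2 * exp (t * ln 2))"])
       (auto intro!: derivative_eq_intros)
  from convex_onD[OF this, of "\<sigma> - 1" 0 1] assms
  have "2 powr (\<sigma> - 1) \<le> \<sigma>" by (simp add: powr_def)
  then have "(2 powr (\<sigma> - 1)) powr (1 / (\<sigma> - 1)) \<le> \<sigma> powr (1 / (\<sigma> - 1))"
    using assms by (intro powr_mono2) auto
  then show ?thesis using assms by (simp add: powr_powr)
qed

lemma curvature_recurrence_step:
  fixes a b c \<sigma> p :: real
  assumes "1 < \<sigma>" "\<sigma> \<le> 2" "0 < c" "0 < a" "0 < b"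
    and p: "p = 1 / (\<sigma> - 1)"
    and rec: "\<And>t. 0 < t \<Longrightarrow> t \<le> 1 \<Longrightarrow> b \<le> (1 - t) * a + t powr \<sigma> / \<sigma> * c"
  shows "a powr (- p) + c powr (- p) / \<sigma> \<le> b powr (- p)"
proof -
  have "0 < p" using assms by simp
  show ?thesis
  proof (cases "a \<le> c")
    case True
    \<comment> \<open>The critical point of the convex bound
      \<open>(1 - t) * a + t powr \<sigma> / \<sigma> * c\<close>: its derivative
      \<open>- a + t powr (\<sigma> - 1) * c\<close> vanishes here, and \<open>a \<le> c\<close>
      keeps it in (0, 1].\<close>
    define t where "t = (a / c) powr p"
    have t: "0 < t" "t \<le> 1"
      using assms True \<open>0 < p\<close> powr_mono2[of p "a / c" 1] by (auto simp: t_def)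
    have "t powr (\<sigma> - 1) = a / c" using assms by (simp add: t_def powr_powr)
    moreover have "t powr \<sigma> = t powr (\<sigma> - 1) * t" using t powr_add[of t "\<sigma> - 1" 1] by simp
    ultimately have tc: "t powr \<sigma> * c = a * t" using assms by simp
    \<comment> \<open>Since \<open>t powr \<sigma> * c = a * t\<close>, the bound at this
      \<open>t\<close> is \<open>a * (1 - q)\<close>; as
      \<open>p * (1 - 1 / \<sigma>) = 1 / \<sigma>\<close>, the Bernoulli gain is
      \<open>t / \<sigma>\<close>.\<close>
    define q where "q = t * (1 - 1 / \<sigma>)"
    have "b \<le> (1 - t) * a + t powr \<sigma> * c / \<sigma>" using rec[OF t] by simp
    then have b: "b \<le> a * (1 - q)" unfolding tc using assms
      by (simp add: q_def field_simps)
    have "0 < 1 / \<sigma>" "1 / \<sigma> < 1" using assms by auto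
    then have "q < 1" using t mult_right_mono[of t 1 "1 - 1 / \<sigma>"] unfolding q_def by argo
    have "p * q = t / \<sigma>" using assms by (simp add: q_def divide_simps)
    then have "1 + t / \<sigma> \<le> (1 - q) powr (- p)"
      using one_minus_powr_ge[of p q] \<open>0 < p\<close> \<open>q < 1\<close> by simp
    then have "a powr (- p) * (1 + t / \<sigma>) \<le> a powr (- p) * (1 - q) powr (- p)"
      by (intro mult_left_mono) auto
    also have "\<dots> = (a * (1 - q)) powr (- p)" using \<open>q < 1\<close> assms by (simp add: powr_mult)
    also have "\<dots> \<le> b powr (- p)" using b assms \<open>0 < p\<close> by (intro powr_mono2') auto
    finally have "a powr (- p) * (1 + t / \<sigma>) \<le> b powr (- p)" .
    \<comment> \<open>This makes the gain independent of \<open>a\<close>.\<close>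
    moreover have "a powr (- p) * t = c powr (- p)"
      using assms by (simp add: t_def powr_divide powr_minus field_simps)
    ultimately show ?thesis by (simp add: algebra_simps)
  next
    case False
    \<comment> \<open>The critical point exceeds 1, so \<open>t = 1\<close> is used, giving
      \<open>b \<le> c / \<sigma>\<close>. Both terms on the left are at most
      \<open>c powr (- p)\<close>, and \<open>2 \<le> \<sigma> powr p\<close> absorbs their
      sum.\<close>
    have "c powr (- p) / \<sigma> \<le> c powr (- p)"
      using assms by (simp add: divide_le_eq mult_le_cancel_left1)
    moreover have "a powr (- p) \<le> c powr (- p)"
      using False assms \<open>0 < p\<close> by (intro powr_mono2') auto
    ultimately have "a powr (- p) + c powr (- p) / \<sigma> \<le> 2 * c powr (- p)" by simp
    also have "\<dots> \<le> \<sigma> powr p * c powr (- p)"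
      using powr_inverse_pred_ge_2[of \<sigma>] assms by (intro mult_right_mono) auto
    also have "\<dots> = (c / \<sigma>) powr (- p)"
      using assms by (simp add: powr_divide powr_minus field_simps)
    also have "\<dots> \<le> b powr (- p)"
      using rec[of 1] assms \<open>0 < p\<close> by (intro powr_mono2') auto
    finally show ?thesis .
  qed
qed

text \<open>Summing the one-step gains gives linear growth of \<open>h k powr (- p)\<close>; the
  decreasing power \<open>- (\<sigma> - 1)\<close>, reciprocal to \<open>- p\<close>, turns this
  lower bound into an upper bound on \<open>h k\<close>.\<close>

lemma curvature_recurrence_rate:
  fixes h :: "nat \<Rightarrow> real" and c \<sigma> :: real
  assumes \<sigma>: "1 < \<sigma>" "\<sigma> \<le> 2" and c: "0 < c"
    and nonneg: "\<And>k. 0 \<le> h k"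
    and decr: "\<And>k. h (Suc k) \<le> h k"
    and rec: "\<And>k t. 0 < t \<Longrightarrow> t \<le> 1 \<Longrightarrow> h (Suc k) \<le> (1 - t) * h k + t powr \<sigma> / \<sigma> * c"
  shows "h k \<le> h 0 / (1 + 1 / \<sigma> * h 0 powr (1 / (\<sigma> - 1)) * c powr (- (1 / (\<sigma> - 1))) * real k)
                       powr (\<sigma> - 1)"
proof -
  define p where "p = 1 / (\<sigma> - 1)"
  have "0 < p" and p\<sigma>: "- p * - (\<sigma> - 1) = 1" using \<sigma> by (auto simp: p_def field_simps)
  \<comment> \<open>Since \<open>0 powr (- p)\<close> is 0, growth can fail once \<open>h k\<close>
    vanishes. By \<open>decr\<close>, a positive value forces all earlier values to be
    positive.\<close>
  have grow: "0 < h k \<Longrightarrow> h 0 powr (- p) + real k * (c powr (- p) / \<sigma>) \<le> h k powr (- p)" for k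
  proof (induction k)
    case (Suc k)
    then have "0 < h k" using decr[of k] by simp
    have "h k powr (- p) + c powr (- p) / \<sigma> \<le> h (Suc k) powr (- p)"
      using \<sigma> c \<open>0 < h k\<close> Suc.prems p_def rec by (rule curvature_recurrence_step)
    with Suc.IH[OF \<open>0 < h k\<close>] show ?case by (simp add: algebra_simps add_divide_distrib)
  qed simp
  define D where "D = 1 + 1 / \<sigma> * h 0 powr p * c powr (- p) * real k"
  have "1 \<le> D" using \<sigma> by (simp add: D_def)
  have "h k \<le> h 0 / D powr (\<sigma> - 1)"
  proof (cases "h k = 0")
    case True
    then show ?thesis using nonneg[of 0] by simp
  next
    case False
    then have "0 < h k" using nonneg[of k] by simp
    have "h k \<le> h 0" by (rule lift_Suc_antimono_le[of h, OF decr]) simp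
    then have "0 < h 0" using \<open>0 < h k\<close> by simp
    have "h 0 powr (- p) * D = h 0 powr (- p) + real k * (c powr (- p) / \<sigma>)"
      using \<open>0 < h 0\<close> by (simp add: D_def powr_minus field_simps)
    then have "h 0 powr (- p) * D \<le> h k powr (- p)" using grow[OF \<open>0 < h k\<close>] by simp
    then have "(h k powr (- p)) powr (- (\<sigma> - 1)) \<le> (h 0 powr (- p) * D) powr (- (\<sigma> - 1))"
      using \<open>1 \<le> D\<close> \<sigma> \<open>0 < h 0\<close> by (intro powr_mono2') auto
    also have "\<dots> = (h 0 powr (- p)) powr (- (\<sigma> - 1)) * D powr (- (\<sigma> - 1))"
      by (rule powr_mult)
    also have "\<dots> = h 0 / D powr (\<sigma> - 1)"
      using \<open>0 < h 0\<close> powr_minus_divide[of D "\<sigma> - 1"] by (simp only: powr_powr p\<sigma>) simp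
    finally show ?thesis using \<open>0 < h k\<close> by (simp only: powr_powr p\<sigma>) simp
  qed
  then show ?thesis by (simp add: D_def p_def)
qed

section \<open>Derivatives along lines, tangents and Hoelder remainders\<close>

lemma has_real_derivative_along_line:
  fixes f :: "'a::real_normed_vector \<Rightarrow> real"
  assumes "(f has_derivative f') (at (x + t *\<^sub>R d))"
  shows "((\<lambda>s. f (x + s *\<^sub>R d)) has_real_derivative f' d) (at t)"
proof -
  interpret f': bounded_linear f' using assms by (rule has_derivative_bounded_linear)
  have "((\<lambda>s. x + s *\<^sub>R d) has_derivative (\<lambda>s. s *\<^sub>R d)) (at t)"
    by (auto intro!: derivative_eq_intros)
  from has_derivative_compose[OF this assms] show ?thesis
    by (rule has_derivative_imp_has_field_derivative) (simp add: f'.scaleR)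
qed

text \<open>Restriction to the line through \<open>x\<close> and \<open>y\<close> reduces this to
  the tangent inequality in one real variable, between the parameters 0 and 1.\<close>

lemma convex_on_above_tangent:
  fixes f :: "'a::real_normed_vector \<Rightarrow> real"
  assumes "convex_on UNIV f" "(f has_derivative f') (at x)"
  shows "f x + f' (y - x) \<le> f y"
proof -
  define \<phi> where "\<phi> t = f (x + t *\<^sub>R (y - x))" for t :: real
  have "convex_on UNIV \<phi>"
  proof (rule convex_onI)
    fix t a b :: real assume t: "0 < t" "t < 1"
    have "x + ((1 - t) *\<^sub>R a + t *\<^sub>R b) *\<^sub>R (y - x)
        = (1 - t) *\<^sub>R (x + a *\<^sub>R (y - x)) + t *\<^sub>R (x + b *\<^sub>R (y - x))"
      by (simp add: algebra_simps)
    then show "\<phi> ((1 - t) *\<^sub>R a + t *\<^sub>R b) \<le> (1 - t) * \<phi> a + t * \<phi> b"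
      using convex_onD[OF assms(1), of t] t by (simp add: \<phi>_def)
  qed simp
  moreover have "(\<phi> has_real_derivative f' (y - x)) (at 0)"
    unfolding \<phi>_def by (rule has_real_derivative_along_line) (use assms(2) in simp)
  ultimately have "f' (y - x) * (1 - 0) \<le> \<phi> 1 - \<phi> 0"
    by (intro convex_on_imp_above_tangent[of UNIV]) auto
  then show ?thesis by (simp add: \<phi>_def)
qed

text \<open>The directional derivative along the segment grows by at most a multiple of
  \<open>t powr \<nu>\<close>. Monotonicity of an auxiliary function replaces integrating this over
  [0, 1], the source of the factor \<open>1 / (1 + \<nu>)\<close>.\<close>

lemma hoelder_derivative_remainder_le:
  fixes f :: "'a::real_normed_vector \<Rightarrow> real" and f' :: "'a \<Rightarrow> 'a \<Rightarrow>\<^sub>L real"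
  assumes df: "\<And>z. (f has_derivative blinfun_apply (f' z)) (at z)"
    and "0 < \<nu>" "0 \<le> L"
    and hoelder: "\<And>u v. norm (f' u - f' v) \<le> L * norm (u - v) powr \<nu>"
  shows "f (x + d) - f x - f' x d \<le> L / (1 + \<nu>) * norm d powr (1 + \<nu>)"
proof -
  define N where "N = norm d powr (1 + \<nu>)"
  \<comment> \<open>Up to the constant \<open>f x\<close>, the remainder at \<open>t\<close> minus
    its claimed bound, so the claim is \<open>\<phi> 1 \<le> \<phi> 0\<close>.\<close>
  define \<phi> where "\<phi> t = f (x + t *\<^sub>R d) - t * f' x d - L / (1 + \<nu>) * t powr (1 + \<nu>) * N" for t :: real
  note line = has_real_derivative_along_line[OF df]
  have "\<phi> 1 \<le> \<phi> 0"
  \<comment> \<open>The power rule for \<open>t powr (1 + \<nu>)\<close> is applied only for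
    \<open>0 < t\<close>; continuity covers the endpoints.\<close>
  proof (rule DERIV_nonpos_imp_decreasing_open[of 0 1 \<phi>])
    fix t :: real assume t: "0 < t" "t < 1"
    have "(\<phi> has_real_derivative f' (x + t *\<^sub>R d) d - f' x d - L * t powr \<nu> * N) (at t)"
      unfolding \<phi>_def using t \<open>0 < \<nu>\<close> by (auto intro!: derivative_eq_intros line)
    moreover have "f' (x + t *\<^sub>R d) d - f' x d \<le> L * t powr \<nu> * N"
    proof -
      have "f' (x + t *\<^sub>R d) d - f' x d \<le> norm (f' (x + t *\<^sub>R d) - f' x) * norm d"
        using norm_blinfun[of "f' (x + t *\<^sub>R d) - f' x" d] by (simp add: blinfun.diff_left)
      also have "\<dots> \<le> L * norm (t *\<^sub>R d) powr \<nu> * norm d"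
        using hoelder[of "x + t *\<^sub>R d" x] by (intro mult_right_mono) auto
      also have "\<dots> = L * t powr \<nu> * N"
        using t by (simp add: N_def powr_mult powr_add)
      finally show ?thesis .
    qed
    ultimately show "\<exists>y. (\<phi> has_real_derivative y) (at t) \<and> y \<le> 0" by (intro exI conjI) auto
  next
    have "continuous_on {0..1} (\<lambda>t. f (x + t *\<^sub>R d))"
      using line by (intro DERIV_atLeastAtMost_imp_continuous_on) auto
    then show "continuous_on {0..1} \<phi>"
      unfolding \<phi>_def using \<open>0 < \<nu>\<close> by (intro continuous_intros continuous_on_powr') auto
  qed simp
  then show ?thesis using \<open>0 < \<nu>\<close> by (simp add: \<phi>_def N_def)
qed

section \<open>Bounds on the curvature constant\<close>

text \<open>The choice \<open>s = x\<close> contributes the value 0 to the supremum.\<close>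

lemma curvature_constant_nonneg:
  assumes "C \<noteq> {}"
  shows "0 \<le> curvature_constant f f' C \<sigma>"
proof -
  obtain z where "z \<in> C" using assms by blast
  have "ereal 0 \<le> curvature_constant f f' C \<sigma>"
    unfolding curvature_constant_def
    by (rule Sup_upper, rule CollectI, rule exI[of _ z], rule exI[of _ z], rule exI[of _ 1],
        rule exI[of _ z]) (use \<open>z \<in> C\<close> in \<open>simp add: zero_ereal_def\<close>)
  then show ?thesis by (simp add: zero_ereal_def)
qed

text \<open>Any real upper bound \<open>c\<close> is allowed, so that a finite curvature constant
  and the Hoelder bound are handled alike.\<close>

lemma curvature_constant_remainder_le:
  assumes "curvature_constant f f' C \<sigma> \<le> ereal c" "0 < \<sigma>"
    and "x \<in> C" "s \<in> C" "0 < t" "t \<le> 1"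
  shows "f (x + t *\<^sub>R (s - x)) - f x - f' x (t *\<^sub>R (s - x)) \<le> t powr \<sigma> / \<sigma> * c"
proof -
  define y where "y = x + t *\<^sub>R (s - x)"
  have "ereal (\<sigma> / t powr \<sigma> * (f y - f x - blinfun_apply (f' x) (y - x)))
      \<le> curvature_constant f f' C \<sigma>"
    unfolding curvature_constant_def by (rule Sup_upper) (use assms y_def in blast)
  then have "\<sigma> / t powr \<sigma> * (f y - f x - blinfun_apply (f' x) (y - x)) \<le> c"
    using assms(1) by (metis ereal_less_eq(3) order_trans)
  then show ?thesis using assms by (simp add: y_def field_simps)
qed

text \<open>The displacement \<open>t *\<^sub>R (s - x)\<close> contributes exactly the factor
  \<open>t powr (1 + \<nu>)\<close> that the normalization of order \<open>1 + \<nu>\<close>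
  cancels.\<close>

lemma hoelder_curvature_constant_le:
  fixes f :: "'a::real_normed_vector \<Rightarrow> real" and f' :: "'a \<Rightarrow> 'a \<Rightarrow>\<^sub>L real"
  assumes "\<And>z. (f has_derivative blinfun_apply (f' z)) (at z)"
    and "0 < \<nu>" "0 \<le> L"
    and "\<And>u v. norm (f' u - f' v) \<le> L * norm (u - v) powr \<nu>"
    and "bounded C"
  shows "curvature_constant f f' C (1 + \<nu>) \<le> ereal (L * diameter C powr (1 + \<nu>))"
  unfolding curvature_constant_def
proof (rule Sup_least, clarify)
  fix x s and t :: real assume *: "x \<in> C" "s \<in> C" "0 < t" "t \<le> 1"
  have "f (x + t *\<^sub>R (s - x)) - f x - f' x (t *\<^sub>R (s - x))
      \<le> L / (1 + \<nu>) * norm (t *\<^sub>R (s - x)) powr (1 + \<nu>)"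
    using assms(1-4) by (rule hoelder_derivative_remainder_le)
  also have "\<dots> = t powr (1 + \<nu>) / (1 + \<nu>) * (L * norm (s - x) powr (1 + \<nu>))"
    using * by (simp add: powr_mult)
  also have "\<dots> \<le> t powr (1 + \<nu>) / (1 + \<nu>) * (L * diameter C powr (1 + \<nu>))"
    using * assms diameter_bounded_bound[OF \<open>bounded C\<close>, of s x]
    by (intro mult_left_mono powr_mono2) (auto simp: dist_norm)
  finally show "ereal ((1 + \<nu>) / t powr (1 + \<nu>) *
      (f (x + t *\<^sub>R (s - x)) - f x - f' x (x + t *\<^sub>R (s - x) - x))) \<le> ereal (L * diameter C powr (1 + \<nu>))"
    using * \<open>0 < \<nu>\<close> by (simp add: field_simps)
qed

section \<open>Frank-Wolfe iterates and their one-step decrease\<close>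

text \<open>Line minimization supplies step sizes in [0, 1], so each new iterate is a convex
  combination of two points of \<open>C\<close>.\<close>

lemma frank_wolfe_sequence_mem:
  assumes "convex C" "frank_wolfe_sequence f' C x xbar \<gamma>" "line_minimization f x xbar \<gamma>"
  shows "x k \<in> C" "xbar k \<in> C"
proof -
  show mem: "xbar k \<in> C" for k
    using assms(2) by (auto simp: frank_wolfe_sequence_def is_arg_min_def)
  show "x k \<in> C"
  proof (induction k)
    case (Suc k)
    have "x (Suc k) = (1 - \<gamma> k) *\<^sub>R x k + \<gamma> k *\<^sub>R xbar k"
      using assms(2) by (simp add: frank_wolfe_sequence_def algebra_simps)
    moreover have "\<gamma> k \<in> {0..1}"
      using assms(3) by (simp add: line_minimization_def is_arg_min_def)
    ultimately show ?case using convexD_alt[OF assms(1) Suc.IH mem[of k], of "\<gamma> k"] by simp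
  qed (use assms(2) in \<open>simp add: frank_wolfe_sequence_def\<close>)
qed

lemma line_minimization_le:
  assumes "frank_wolfe_sequence f' C x xbar \<gamma>" "line_minimization f x xbar \<gamma>" "0 \<le> t" "t \<le> 1"
  shows "f (x (Suc k)) \<le> f (x k + t *\<^sub>R (xbar k - x k))"
  using assms by (auto simp: frank_wolfe_sequence_def line_minimization_def is_arg_min_linorder)

text \<open>Any \<open>t\<close> may be tried because the line search does at least as well. The
  linear term is controlled by minimality of \<open>xbar k\<close> against \<open>z\<close> and the
  tangent inequality, the remainder by the curvature bound.\<close>

lemma frank_wolfe_curvature_recurrence:
  fixes f :: "'a::real_normed_vector \<Rightarrow> real"
  assumes "convex C" "convex_on UNIV f"
    and df: "\<And>z. (f has_derivative blinfun_apply (f' z)) (at z)"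
    and fw: "frank_wolfe_sequence f' C x xbar \<gamma>" and ls: "line_minimization f x xbar \<gamma>"
    and curv: "curvature_constant f f' C \<sigma> \<le> ereal c" "0 < \<sigma>"
    and "z \<in> C" and t: "0 < t" "t \<le> 1"
  shows "f (x (Suc k)) - f z \<le> (1 - t) * (f (x k) - f z) + t powr \<sigma> / \<sigma> * c"
proof -
  note mem = frank_wolfe_sequence_mem[OF \<open>convex C\<close> fw ls]
  have "f' (x k) (xbar k) \<le> f' (x k) z"
    using fw \<open>z \<in> C\<close> by (simp add: frank_wolfe_sequence_def is_arg_min_linorder)
  then have "f' (x k) (xbar k - x k) \<le> f z - f (x k)"
    using convex_on_above_tangent[OF assms(2) df, of "x k" z] by (simp add: blinfun.diff_right)
  then have "t * f' (x k) (xbar k - x k) \<le> t * (f z - f (x k))" using t by simp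
  moreover have "f (x (Suc k)) \<le> f (x k + t *\<^sub>R (xbar k - x k))"
    using line_minimization_le[OF fw ls] t by simp
  moreover have "f (x k + t *\<^sub>R (xbar k - x k)) - f (x k) - f' (x k) (t *\<^sub>R (xbar k - x k))
      \<le> t powr \<sigma> / \<sigma> * c"
    using curv mem t by (rule curvature_constant_remainder_le)
  ultimately have "f (x (Suc k)) \<le> f (x k) + t * (f z - f (x k)) + t powr \<sigma> / \<sigma> * c"
    unfolding blinfun.scaleR_right real_scaleR_def by linarith
  then show ?thesis by (simp add: algebra_simps)
qed

section \<open>Asymptotics and evaluation of the extended-real bound\<close>

text \<open>Dropping the summand 1 from the base leaves a multiple of
  \<open>1 / real k powr p\<close>. The alternative \<open>\<theta> = 0\<close> is there because the
  coefficient \<open>a\<close> used later contains a power of \<open>\<theta>\<close> and vanishes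
  with it.\<close>

lemma inverse_affine_powr_bigo:
  fixes \<theta> a p :: real
  assumes "0 \<le> p" "0 < a \<or> \<theta> = 0"
  shows "(\<lambda>k. \<theta> / (1 + a * real k) powr p) \<in> O(\<lambda>k. 1 / real k powr p)"
proof (cases "\<theta> = 0")
  case False
  then have "0 < a" using assms by simp
  show ?thesis
  proof (rule bigoI[where c="\<bar>\<theta>\<bar> / a powr p"], rule eventually_sequentiallyI[of 1])
    fix k :: nat assume k: "1 \<le> k"
    have "a powr p * real k powr p \<le> (1 + a * real k) powr p"
      using \<open>0 < a\<close> \<open>0 \<le> p\<close> by (simp flip: powr_mult add: powr_mono2)
    moreover have "0 < 1 + a * real k" using \<open>0 < a\<close> by (simp add: add_pos_nonneg)
    ultimately have "\<bar>\<theta>\<bar> / (1 + a * real k) powr p \<le> \<bar>\<theta>\<bar> / (a powr p * real k powr p)"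
      using \<open>0 < a\<close> k by (intro divide_left_mono mult_pos_pos) auto
    then show "norm (\<theta> / (1 + a * real k) powr p) \<le> \<bar>\<theta>\<bar> / a powr p * norm (1 / real k powr p)"
      by simp
  qed
qed simp

text \<open>No infinite value arises: \<open>c\<close> is positive and the base of the outer power
  is at least 1, so \<open>epowr\<close> reduces to \<open>powr\<close> in both places.\<close>

lemma curvature_rate_pos:
  assumes "1 < \<sigma>" "0 < c"
  shows "curvature_rate \<sigma> \<theta> (ereal c) k
    = ereal (\<theta> / (1 + 1 / \<sigma> * \<theta> powr (1 / (\<sigma> - 1)) * c powr (- (1 / (\<sigma> - 1))) * real k) powr (\<sigma> - 1))"
proof -
  define D where "D = 1 + 1 / \<sigma> * \<theta> powr (1 / (\<sigma> - 1)) * c powr (- (1 / (\<sigma> - 1))) * real k"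
  have "1 \<le> D" using assms by (simp add: D_def)
  have "1 / (1 - \<sigma>) = - (1 / (\<sigma> - 1))" using assms by (simp add: field_simps)
  then have "1 + ereal (1 / \<sigma>) * ereal (\<theta> powr (1 / (\<sigma> - 1))) * epowr (ereal c) (1 / (1 - \<sigma>))
      * ereal (real k) = ereal D"
    using assms by (simp add: epowr_def D_def one_ereal_def)
  moreover have "epowr (ereal D) (\<sigma> - 1) = ereal (D powr (\<sigma> - 1))"
    using assms \<open>1 \<le> D\<close> by (simp add: epowr_def)
  ultimately show ?thesis using \<open>1 \<le> D\<close> by (simp only: curvature_rate_def flip: D_def) simp
qed

text \<open>The negative power of 0 is \<open>\<infinity>\<close>, so the denominator is infinite
  unless \<open>k = 0\<close> or \<open>\<theta> = 0\<close>, where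
  \<open>0 * \<infinity> = 0\<close> reduces it to 1.\<close>

lemma curvature_rate_0:
  assumes "1 < \<sigma>" "0 \<le> \<theta>"
  shows "curvature_rate \<sigma> \<theta> 0 k = (if k = 0 then ereal \<theta> else 0)"
  using assms
  by (cases "\<theta> = 0")
     (auto simp: curvature_rate_def epowr_def simp flip: zero_ereal_def one_ereal_def)

section \<open>Convergence rates under finite curvature, Hoelder and Lipschitz assumptions\<close>

theorem theorem4p9:
  fixes C :: "'a::banach set"
    and f :: "'a \<Rightarrow> real"
    and f' :: "'a \<Rightarrow> 'a \<Rightarrow>\<^sub>L real"
    and xstar :: 'a
    and x xbar :: "nat \<Rightarrow> 'a"
    and \<gamma> :: "nat \<Rightarrow> real"
    and \<delta> fstar \<theta> :: real
  assumes "C \<noteq> {}" and "closed C" and "bounded C" and "convex C"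
    and "compactin weak_topology C"
    and "\<delta> = diameter C"
    and "convex_on UNIV f"
    and "\<And>z. (f has_derivative blinfun_apply (f' z)) (at z)"
    and "continuous_on UNIV f'"
    and "uniformly_continuous_on C f'"
    and "is_arg_min f (\<lambda>z. z \<in> C) xstar"
    and "fstar = f xstar"
    and "frank_wolfe_sequence f' C x xbar \<gamma>"
    and "line_minimization f x xbar \<gamma>"
    and "\<theta> = f (x 0) - fstar"
  shows
    "(\<forall>\<sigma>. 1 < \<sigma> \<and> \<sigma> \<le> 2 \<and> curvature_constant f f' C \<sigma> < \<infinity> \<longrightarrow>
        (\<forall>k. ereal (f (x k) - fstar) \<le> curvature_rate \<sigma> \<theta> (curvature_constant f f' C \<sigma>) k) \<and>
        (\<lambda>k. real_of_ereal (curvature_rate \<sigma> \<theta> (curvature_constant f f' C \<sigma>) k))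
          \<in> O(\<lambda>k. 1 / real k powr (\<sigma> - 1)))
     \<and> (\<forall>\<nu> L. 0 < \<nu> \<and> \<nu> \<le> 1 \<and> 0 < L \<and>
            (\<forall>u v. norm (f' u - f' v) \<le> L * norm (u - v) powr \<nu>) \<longrightarrow>
        (\<forall>k. f (x k) - fstar \<le>
           \<theta> / (1 + 1 / (1 + \<nu>) * \<theta> powr (1 / \<nu>) * (L * \<delta> powr (1 + \<nu>)) powr (- (1 / \<nu>)) * real k) powr \<nu>) \<and>
        (\<lambda>k. \<theta> / (1 + 1 / (1 + \<nu>) * \<theta> powr (1 / \<nu>) * (L * \<delta> powr (1 + \<nu>)) powr (- (1 / \<nu>)) * real k) powr \<nu>)
          \<in> O(\<lambda>k. 1 / real k powr \<nu>))
     \<and> (\<forall>L. 0 < L \<and> L-lipschitz_on UNIV f' \<longrightarrow>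
        (\<forall>k. f (x k) - fstar \<le> \<theta> / (1 + \<theta> / (2 * L * \<delta>\<^sup>2) * real k)) \<and>
        (\<lambda>k. \<theta> / (1 + \<theta> / (2 * L * \<delta>\<^sup>2) * real k)) \<in> O(\<lambda>k. 1 / real k))"
proof -
  note fw = assms(13) and ls = assms(14)
  have xstar: "xstar \<in> C" and min: "\<And>z. z \<in> C \<Longrightarrow> f xstar \<le> f z"
    using assms(11) by (auto simp: is_arg_min_linorder)
  note mem = frank_wolfe_sequence_mem[OF assms(4) fw ls]
  note recurrence = frank_wolfe_curvature_recurrence[OF assms(4,7,8) fw ls _ _ xstar,
      folded assms(12)]
  have nonneg: "0 \<le> f (x k) - fstar" for k using min[OF mem(1)[of k]] assms(12) by simp
  then have \<theta>: "0 \<le> \<theta>" using assms(15) by simp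
  \<comment> \<open>One real-valued rate for every positive upper bound \<open>c\<close> on the
    curvature constant serves the curvature and Hoelder cases; \<open>c = 0\<close> and
    \<open>\<delta> = 0\<close> are treated separately.\<close>
  have rate: "f (x k) - fstar
      \<le> \<theta> / (1 + 1 / \<sigma> * \<theta> powr (1 / (\<sigma> - 1)) * c powr (- (1 / (\<sigma> - 1))) * real k) powr (\<sigma> - 1)"
    if "1 < \<sigma>" "\<sigma> \<le> 2" "0 < c" "curvature_constant f f' C \<sigma> \<le> ereal c" for \<sigma> c k
    unfolding assms(15) using that(1-3) nonneg
  proof (rule curvature_recurrence_rate[where h="\<lambda>k. f (x k) - fstar"])
    \<comment> \<open>The parameter 0 in the line search compares with staying at
      \<open>x k\<close>.\<close>
    show "f (x (Suc k)) - fstar \<le> f (x k) - fstar" for k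
      using line_minimization_le[OF fw ls, of 0 k] by simp
    show "f (x (Suc k)) - fstar \<le> (1 - t) * (f (x k) - fstar) + t powr \<sigma> / \<sigma> * c"
      if "0 < t" "t \<le> 1" for k t
      using recurrence[of \<sigma> c t k] \<open>1 < \<sigma>\<close> \<open>curvature_constant f f' C \<sigma> \<le> ereal c\<close> that by simp
  qed
  have curvature:
    "(\<forall>k. ereal (f (x k) - fstar) \<le> curvature_rate \<sigma> \<theta> (curvature_constant f f' C \<sigma>) k) \<and>
     (\<lambda>k. real_of_ereal (curvature_rate \<sigma> \<theta> (curvature_constant f f' C \<sigma>) k))
       \<in> O(\<lambda>k. 1 / real k powr (\<sigma> - 1))"
    if \<sigma>: "1 < \<sigma>" "\<sigma> \<le> 2" and fin: "curvature_constant f f' C \<sigma> < \<infinity>" for \<sigma>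
  proof -
    obtain c where c: "curvature_constant f f' C \<sigma> = ereal c" "0 \<le> c"
      using curvature_constant_nonneg[OF assms(1), of f f' \<sigma>] fin
      by (cases "curvature_constant f f' C \<sigma>") auto
    show ?thesis
    proof (cases "c = 0")
      case True
      \<comment> \<open>With \<open>c = 0\<close> the recurrence at \<open>t = 1\<close> has
        right-hand side 0, so the optimum is reached after a single step.\<close>
      have "f (x (Suc k)) - fstar \<le> 0" for k
        using recurrence[of \<sigma> c 1 k] \<sigma> c True by simp
      then have "ereal (f (x k) - fstar) \<le> (if k = 0 then ereal \<theta> else 0)" for k
        using assms(15) by (cases k) auto
      moreover have "(\<lambda>k. real_of_ereal (if k = 0 then ereal \<theta> else 0))
          \<in> O(\<lambda>k. 1 / real k powr (\<sigma> - 1))"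
        by (rule bigoI[where c=0], rule eventually_sequentiallyI[of 1]) simp
      ultimately show ?thesis
        using curvature_rate_0[OF \<sigma>(1) \<theta>] c True by (simp flip: zero_ereal_def)
    next
      case False
      then have "0 < c" using c by simp
      then have "0 < 1 / \<sigma> * \<theta> powr (1 / (\<sigma> - 1)) * c powr (- (1 / (\<sigma> - 1))) \<or> \<theta> = 0"
        using \<theta> \<sigma> by auto
      from inverse_affine_powr_bigo[OF _ this, of "\<sigma> - 1"] rate[OF \<sigma> \<open>0 < c\<close>] c \<sigma> \<open>0 < c\<close>
      show ?thesis by (simp add: curvature_rate_pos)
    qed
  qed
  have \<delta>0: "0 \<le> \<delta>" using assms(3,6) diameter_ge_0 by blast
  \<comment> \<open>At diameter 0 all points of \<open>C\<close> coincide, so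
    \<open>x 0 = xstar\<close>.\<close>
  have degenerate: "\<theta> = 0" if "\<delta> = 0"
    using diameter_bounded_bound[OF assms(3) mem(1)[of 0] xstar] that assms(6,12,15) by simp
  have hoelder:
    "(\<forall>k. f (x k) - fstar \<le>
        \<theta> / (1 + 1 / (1 + \<nu>) * \<theta> powr (1 / \<nu>) * (L * \<delta> powr (1 + \<nu>)) powr (- (1 / \<nu>)) * real k) powr \<nu>) \<and>
     (\<lambda>k. \<theta> / (1 + 1 / (1 + \<nu>) * \<theta> powr (1 / \<nu>) * (L * \<delta> powr (1 + \<nu>)) powr (- (1 / \<nu>)) * real k) powr \<nu>)
       \<in> O(\<lambda>k. 1 / real k powr \<nu>)"
    if \<nu>: "0 < \<nu>" "\<nu> \<le> 1" and L: "0 < L"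
      and h: "\<And>u v. norm (f' u - f' v) \<le> L * norm (u - v) powr \<nu>" for \<nu> L
  proof (cases "\<delta> = 0")
    case True
    \<comment> \<open>Here \<open>L * \<delta> powr (1 + \<nu>)\<close> is 0, so \<open>rate\<close>
      does not apply; but \<open>\<theta> = 0\<close> makes the claimed bound 0, and monotonicity
      suffices.\<close>
    have "f (x k) - fstar \<le> f (x 0) - fstar" for k
      using lift_Suc_antimono_le[of "\<lambda>k. f (x k)" 0 k] line_minimization_le[OF fw ls, of 0] by simp
    then show ?thesis using degenerate[OF True] assms(15) by simp
  next
    case False
    then have pos: "0 < L * \<delta> powr (1 + \<nu>)" using L by simp
    have "curvature_constant f f' C (1 + \<nu>) \<le> ereal (L * \<delta> powr (1 + \<nu>))"
      unfolding assms(6) using assms(8) \<nu>(1) _ h assms(3)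
      by (rule hoelder_curvature_constant_le) (use L in simp)
    from rate[OF _ _ pos this] \<nu>
    have "f (x k) - fstar \<le>
        \<theta> / (1 + 1 / (1 + \<nu>) * \<theta> powr (1 / \<nu>) * (L * \<delta> powr (1 + \<nu>)) powr (- (1 / \<nu>)) * real k) powr \<nu>" for k
      by simp
    moreover have "0 < 1 / (1 + \<nu>) * \<theta> powr (1 / \<nu>) * (L * \<delta> powr (1 + \<nu>)) powr (- (1 / \<nu>)) \<or> \<theta> = 0"
      using \<theta> \<nu> pos
      by (cases "\<theta> = 0") (auto intro!: mult_pos_pos divide_pos_pos)
    ultimately show ?thesis using inverse_affine_powr_bigo[OF less_imp_le[OF \<nu>(1)]] by blast
  qed
  have lipschitz:
    "(\<forall>k. f (x k) - fstar \<le> \<theta> / (1 + \<theta> / (2 * L * \<delta>\<^sup>2) * real k)) \<and>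
     (\<lambda>k. \<theta> / (1 + \<theta> / (2 * L * \<delta>\<^sup>2) * real k)) \<in> O(\<lambda>k. 1 / real k)"
    if L: "0 < L" "L-lipschitz_on UNIV f'" for L
  proof -
    \<comment> \<open>The left side is the Hoelder bound verbatim at \<open>\<nu> = 1\<close>, so
      that it can be rewritten in that result.\<close>
    have eq: "\<theta> / (1 + 1 / (1 + 1) * \<theta> powr (1 / 1) * (L * \<delta> powr (1 + 1)) powr (- (1 / 1)) * real k) powr 1
        = \<theta> / (1 + \<theta> / (2 * L * \<delta>\<^sup>2) * real k)" for k
    proof -
      \<comment> \<open>For \<open>\<delta> = 0\<close> both sides are 0, by the conventions for
        \<open>powr\<close> at 0 and for division by 0.\<close>
      have "(L * \<delta> powr (1 + 1)) powr (- (1 / 1)) = 1 / (L * \<delta>\<^sup>2)"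
        using L \<delta>0 by (cases "\<delta> = 0") (simp_all add: powr_minus_divide)
      \<comment> \<open>Nonnegativity of the base allows the outer \<open>powr 1\<close> to be
        removed.\<close>
      moreover have "0 \<le> 1 + \<theta> / (2 * L * \<delta>\<^sup>2) * real k" using L \<theta> by simp
      ultimately show ?thesis using \<theta> by simp
    qed
    have "norm (f' u - f' v) \<le> L * norm (u - v) powr 1" for u v
      using lipschitz_onD[OF L(2), of u v] by (simp add: dist_norm)
    from hoelder[OF _ _ L(1) this] show ?thesis by (simp only: eq) simp
  qed
  show ?thesis using curvature hoelder lipschitz by blast
qed

end
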